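(* Let $K$ be a field, $(A,\circ,\alpha_A,\beta_A)$ a BiHom-pre-Lie algebra, and $M$ a vector space with linear maps $A\otimes M\to M$, $a\otimes m\mapsto a\circ_\ell m$, and $M\otimes A\to M$, $m\otimes a\mapsto m\circ_r a$, and two commuting linear maps $\alpha_M,\beta_M:M\to M$. Define on $A\oplus M$ $$(a+m)\circ_{A\oplus M}(a'+m')=a\circ a'+a\circ_\ell m'+m\circ_r a',\qquad a,a'\in A,\ m,m'\in M.$$ Then $(A\oplus M,\circ_{A\oplus M},\alpha_A\oplus\alpha_M,\beta_A\oplus\beta_M)$ is a BiHom-pre-Lie algebra if and only if $(M,\circ_\ell,\circ_r,\alpha_M,\beta_M)$ is a BiHom-pre-Lie bimodule over $(A,\circ,\alpha_A,\beta_A)$.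
   Context: $(f\oplus g)(a+m)=f(a)+g(m)$. Everything is over the field $K$. (Left) BiHom-pre-Lie algebra $(A,\circ,\alpha,\beta)$: bilinear $\circ$, commuting linear multiplicative $\alpha,\beta$, with $\alpha\beta(a)\circ(\alpha(b)\circ c)-(\beta(a)\circ\alpha(b))\circ\beta(c)=\alpha\beta(b)\circ(\alpha(a)\circ c)-(\beta(b)\circ\alpha(a))\circ\beta(c)$. BiHom-pre-Lie bimodule $(M,\circ_\ell,\circ_r,\alpha_M,\beta_M)$ over it: linear $\circ_\ell:A\otimes M\to M$, $\circ_r:M\otimes A\to M$, commuting linear $\alpha_M,\beta_M$ with $f_M(a\circ_\ell m)=f_A(a)\circ_\ell f_M(m)$, $f_M(m\circ_r a)=f_M(m)\circ_r f_A(a)$ for $f\in\{\alpha,\beta\}$, and $\alpha_A\beta_A(a)\circ_\ell(\alpha_A(b)\circ_\ell m)-(\beta_A(a)\circ\alpha_A(b))\circ_\ell\beta_M(m)=\alpha_A\beta_A(b)\circ_\ell(\alpha_A(a)\circ_\ell m)-(\beta_A(b)\circ\alpha_A(a))\circ_\ell\beta_M(m)$, $\alpha_A\beta_A(a)\circ_\ell(\alpha_M(m)\circ_r c)-(\beta_A(a)\circ_\ell\alpha_M(m))\circ_r\beta_A(c)=\alpha_M\beta_M(m)\circ_r(\alpha_A(a)\circ c)-(\beta_M(m)\circ_r\alpha_A(a))\circ_r\beta_A(c)$ for all $a,b,c\in A$, $m\in M$. *)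

theory Defs
  imports "HOL-Analysis.Product_Vector"
begin

text \<open>Vector spaces over an arbitrary field \<^typ>\<open>'k\<close> are given by their scalar multiplication, as in
  \<^locale>\<open>vector_space\<close>.  Linear maps out of a tensor product \<open>U \<otimes> V\<close> are rendered as
  bilinear maps on \<open>U \<times> V\<close>.\<close>

definition bilinear_map ::
  "('k::field \<Rightarrow> 'u::ab_group_add \<Rightarrow> 'u) \<Rightarrow> ('k \<Rightarrow> 'v::ab_group_add \<Rightarrow> 'v) \<Rightarrow>
   ('k \<Rightarrow> 'w::ab_group_add \<Rightarrow> 'w) \<Rightarrow> ('u \<Rightarrow> 'v \<Rightarrow> 'w) \<Rightarrow> bool"
  where "bilinear_map s1 s2 s3 f \<longleftrightarrow>
    (\<forall>y. Vector_Spaces.linear s1 s3 (\<lambda>x. f x y)) \<and> (\<forall>x. Vector_Spaces.linear s2 s3 (\<lambda>y. f x y))"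

locale bihom_pre_lie_algebra = vector_space scale
  for scale :: "'k::field \<Rightarrow> 'a::ab_group_add \<Rightarrow> 'a" +
  fixes mult :: "'a \<Rightarrow> 'a \<Rightarrow> 'a" (infixl \<open>\<circ>\<^sub>A\<close> 70)
    and \<alpha> \<beta> :: "'a \<Rightarrow> 'a"
  assumes mult_bilinear: "bilinear_map scale scale scale (\<circ>\<^sub>A)"
    and \<alpha>_linear: "Vector_Spaces.linear scale scale \<alpha>"
    and \<beta>_linear: "Vector_Spaces.linear scale scale \<beta>"
    and \<alpha>_\<beta>_commute: "\<alpha> \<circ> \<beta> = \<beta> \<circ> \<alpha>"
    and \<alpha>_mult: "\<alpha> (a \<circ>\<^sub>A b) = \<alpha> a \<circ>\<^sub>A \<alpha> b"
    and \<beta>_mult: "\<beta> (a \<circ>\<^sub>A b) = \<beta> a \<circ>\<^sub>A \<beta> b"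
    and pre_lie:
      "\<alpha> (\<beta> a) \<circ>\<^sub>A (\<alpha> b \<circ>\<^sub>A c) - (\<beta> a \<circ>\<^sub>A \<alpha> b) \<circ>\<^sub>A \<beta> c =
       \<alpha> (\<beta> b) \<circ>\<^sub>A (\<alpha> a \<circ>\<^sub>A c) - (\<beta> b \<circ>\<^sub>A \<alpha> a) \<circ>\<^sub>A \<beta> c"

locale bihom_pre_lie_bimodule =
  A: bihom_pre_lie_algebra scaleA mult \<alpha>\<^sub>A \<beta>\<^sub>A + M: vector_space scaleM
  for scaleA :: "'k::field \<Rightarrow> 'a::ab_group_add \<Rightarrow> 'a"
    and mult :: "'a \<Rightarrow> 'a \<Rightarrow> 'a" (infixl \<open>\<circ>\<^sub>A\<close> 70)
    and \<alpha>\<^sub>A \<beta>\<^sub>A :: "'a \<Rightarrow> 'a"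
    and scaleM :: "'k \<Rightarrow> 'm::ab_group_add \<Rightarrow> 'm" +
  fixes lact :: "'a \<Rightarrow> 'm \<Rightarrow> 'm" (infixl \<open>\<circ>\<^sub>l\<close> 70)
    and ract :: "'m \<Rightarrow> 'a \<Rightarrow> 'm" (infixl \<open>\<circ>\<^sub>r\<close> 70)
    and \<alpha>\<^sub>M \<beta>\<^sub>M :: "'m \<Rightarrow> 'm"
  assumes lact_bilinear: "bilinear_map scaleA scaleM scaleM (\<circ>\<^sub>l)"
    and ract_bilinear: "bilinear_map scaleM scaleA scaleM (\<circ>\<^sub>r)"
    and \<alpha>\<^sub>M_linear: "Vector_Spaces.linear scaleM scaleM \<alpha>\<^sub>M"
    and \<beta>\<^sub>M_linear: "Vector_Spaces.linear scaleM scaleM \<beta>\<^sub>M"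
    and \<alpha>\<^sub>M_\<beta>\<^sub>M_commute: "\<alpha>\<^sub>M \<circ> \<beta>\<^sub>M = \<beta>\<^sub>M \<circ> \<alpha>\<^sub>M"
    and \<alpha>\<^sub>M_lact: "\<alpha>\<^sub>M (a \<circ>\<^sub>l m) = \<alpha>\<^sub>A a \<circ>\<^sub>l \<alpha>\<^sub>M m"
    and \<beta>\<^sub>M_lact: "\<beta>\<^sub>M (a \<circ>\<^sub>l m) = \<beta>\<^sub>A a \<circ>\<^sub>l \<beta>\<^sub>M m"
    and \<alpha>\<^sub>M_ract: "\<alpha>\<^sub>M (m \<circ>\<^sub>r a) = \<alpha>\<^sub>M m \<circ>\<^sub>r \<alpha>\<^sub>A a"
    and \<beta>\<^sub>M_ract: "\<beta>\<^sub>M (m \<circ>\<^sub>r a) = \<beta>\<^sub>M m \<circ>\<^sub>r \<beta>\<^sub>A a"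
    and bimodule_left:
      "\<alpha>\<^sub>A (\<beta>\<^sub>A a) \<circ>\<^sub>l (\<alpha>\<^sub>A b \<circ>\<^sub>l m) - (\<beta>\<^sub>A a \<circ>\<^sub>A \<alpha>\<^sub>A b) \<circ>\<^sub>l \<beta>\<^sub>M m =
       \<alpha>\<^sub>A (\<beta>\<^sub>A b) \<circ>\<^sub>l (\<alpha>\<^sub>A a \<circ>\<^sub>l m) - (\<beta>\<^sub>A b \<circ>\<^sub>A \<alpha>\<^sub>A a) \<circ>\<^sub>l \<beta>\<^sub>M m"
    and bimodule_right:
      "\<alpha>\<^sub>A (\<beta>\<^sub>A a) \<circ>\<^sub>l (\<alpha>\<^sub>M m \<circ>\<^sub>r c) - (\<beta>\<^sub>A a \<circ>\<^sub>l \<alpha>\<^sub>M m) \<circ>\<^sub>r \<beta>\<^sub>A c =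
       \<alpha>\<^sub>M (\<beta>\<^sub>M m) \<circ>\<^sub>r (\<alpha>\<^sub>A a \<circ>\<^sub>A c) - (\<beta>\<^sub>M m \<circ>\<^sub>r \<alpha>\<^sub>A a) \<circ>\<^sub>r \<beta>\<^sub>A c"

text \<open>The direct sum \<open>A \<oplus> M\<close> is the product type with the library's componentwise addition and
  scalar multiplication \<^const>\<open>module_prod.scale\<close>; the pair \<open>(a, m)\<close> stands for \<open>a + m\<close>, and
  \<open>f \<oplus> g\<close> is \<^const>\<open>map_prod\<close>.\<close>

definition sum_mult ::
  "('a \<Rightarrow> 'a \<Rightarrow> 'a) \<Rightarrow> ('a \<Rightarrow> 'm::ab_group_add \<Rightarrow> 'm) \<Rightarrow> ('m \<Rightarrow> 'a \<Rightarrow> 'm) \<Rightarrow>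
   'a \<times> 'm \<Rightarrow> 'a \<times> 'm \<Rightarrow> 'a \<times> 'm"
  where "sum_mult mult lact ract = (\<lambda>(a, m) (a', m'). (mult a a', lact a m' + ract m a'))"

end

theory Submission
  imports Defs
begin

text \<open>Expanding the pre-Lie identity on \<open>A \<oplus> M\<close> at \<open>(a, m)\<close>, \<open>(b, n)\<close>, \<open>(c, p)\<close>, the \<open>A\<close>-component is
  the identity of \<open>A\<close>, while the \<open>M\<close>-component is a sum of three independent pieces: the part in \<open>p\<close>
  is the left bimodule identity, and the parts in \<open>n\<close> and in \<open>m\<close> are the right bimodule identity and
  its mirror image under exchanging the first two arguments. Setting all but one of \<open>m, n, p\<close> to
  zero therefore recovers the bimodule axioms; multiplicativity of the structure maps splits in the
  same way.\<close>

text \<open>Spells bilinearity out as equations that can be checked component by component.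
  \<open>Vector_Spaces.linear\<close> includes the vector space axioms of both sides, hence the
  three premises.\<close>

lemma bilinear_map_iff:
  assumes "vector_space s1" "vector_space s2" "vector_space s3"
  shows "bilinear_map s1 s2 s3 f \<longleftrightarrow>
    (\<forall>x x' y. f (x + x') y = f x y + f x' y) \<and> (\<forall>c x y. f (s1 c x) y = s3 c (f x y)) \<and>
    (\<forall>x y y'. f x (y + y') = f x y + f x y') \<and> (\<forall>c x y. f x (s2 c y) = s3 c (f x y))"
  using assms unfolding bilinear_map_def Vector_Spaces.linear_iff by blast

lemma bilinear_map_left:
  "bilinear_map s1 s2 s3 f \<Longrightarrow> Vector_Spaces.linear s1 s3 (\<lambda>x. f x y)"
  by (simp add: bilinear_map_def)

lemma bilinear_map_right:
  "bilinear_map s1 s2 s3 f \<Longrightarrow> Vector_Spaces.linear s2 s3 (f x)"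
  by (simp add: bilinear_map_def)

lemma vector_space_prod_scale:
  assumes "vector_space s1" "vector_space s2"
  shows "vector_space (module_prod.scale s1 s2)"
proof -
  interpret vector_space_prod s1 s2
    using assms by (simp add: vector_space_prod_def vector_space_pair_def)
  show ?thesis by (fact p.vector_space_axioms)
qed

lemma module_prod_scale_apply:
  assumes "vector_space s1" "vector_space s2"
  shows "module_prod.scale s1 s2 c (x, y) = (s1 c x, s2 c y)"
proof -
  interpret vector_space_prod s1 s2
    using assms by (simp add: vector_space_prod_def vector_space_pair_def)
  show ?thesis by (fact scale_prod)
qed

lemma linear_map_prod:
  assumes "Vector_Spaces.linear s1 s1' f" "Vector_Spaces.linear s2 s2' g"
  shows "Vector_Spaces.linear (module_prod.scale s1 s2) (module_prod.scale s1' s2') (map_prod f g)"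
  using assms
  by (auto simp: Vector_Spaces.linear_iff vector_space_prod_scale module_prod_scale_apply)

text \<open>The second component is a sum of two maps, each bilinear by assumption; scalars
  distribute over that sum, and additivity only needs its summands reordered.\<close>

lemma bilinear_map_sum_mult:
  assumes "bilinear_map s1 s1 s1 f" "bilinear_map s1 s2 s2 l" "bilinear_map s2 s1 s2 r"
    and "vector_space s1" "vector_space s2"
  shows "bilinear_map (module_prod.scale s1 s2) (module_prod.scale s1 s2) (module_prod.scale s1 s2)
           (sum_mult f l r)"
  using assms
  by (auto simp: bilinear_map_iff vector_space_prod_scale module_prod_scale_apply sum_mult_def
      vector_space.vector_space_assms(1) ac_simps)

text \<open>Adds the first two equations to the third read backwards. The terms stand in the order
  in which \<open>sum_mult\<close> produces them in the second component of the pre-Lie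
  identity.\<close>

lemma sum_diff_regroup:
  fixes p :: "'a::ab_group_add"
  assumes "p - p' = q - q'" "u - u' = v - v'" "w - w' = z - z'"
  shows "p + u + z - (p' + (u' + z')) = q + w + v - (q' + (w' + v'))"
proof -
  have "p + u + z - (p' + (u' + z')) = (p - p') + (u - u') + (z - z')"
    by (simp add: algebra_simps)
  also have "\<dots> = (q - q') + (v - v') + (w - w')"
    by (simp only: assms)
  also have "\<dots> = q + w + v - (q' + (w' + v'))"
    by (simp add: algebra_simps)
  finally show ?thesis .
qed

lemma sum_mult_apply [simp]:
  "sum_mult f l r (a, m) (b, n) = (f a b, l a n + r m b)"
  by (simp add: sum_mult_def)

theorem proposition2p38:
  fixes scaleA :: "'k::field \<Rightarrow> 'a::ab_group_add \<Rightarrow> 'a"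
    and scaleM :: "'k \<Rightarrow> 'm::ab_group_add \<Rightarrow> 'm"
    and mult :: "'a \<Rightarrow> 'a \<Rightarrow> 'a"
    and \<alpha>\<^sub>A \<beta>\<^sub>A :: "'a \<Rightarrow> 'a"
    and lact :: "'a \<Rightarrow> 'm \<Rightarrow> 'm"
    and ract :: "'m \<Rightarrow> 'a \<Rightarrow> 'm"
    and \<alpha>\<^sub>M \<beta>\<^sub>M :: "'m \<Rightarrow> 'm"
  assumes "bihom_pre_lie_algebra scaleA mult \<alpha>\<^sub>A \<beta>\<^sub>A"
    and "vector_space scaleM"
    and "bilinear_map scaleA scaleM scaleM lact"
    and "bilinear_map scaleM scaleA scaleM ract"
    and "Vector_Spaces.linear scaleM scaleM \<alpha>\<^sub>M"
    and "Vector_Spaces.linear scaleM scaleM \<beta>\<^sub>M"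
    and "\<alpha>\<^sub>M \<circ> \<beta>\<^sub>M = \<beta>\<^sub>M \<circ> \<alpha>\<^sub>M"
  shows "bihom_pre_lie_algebra (module_prod.scale scaleA scaleM) (sum_mult mult lact ract)
           (map_prod \<alpha>\<^sub>A \<alpha>\<^sub>M) (map_prod \<beta>\<^sub>A \<beta>\<^sub>M)
         \<longleftrightarrow> bihom_pre_lie_bimodule scaleA mult \<alpha>\<^sub>A \<beta>\<^sub>A scaleM lact ract \<alpha>\<^sub>M \<beta>\<^sub>M"
proof -
  interpret A: bihom_pre_lie_algebra scaleA mult \<alpha>\<^sub>A \<beta>\<^sub>A by fact
  interpret M: vector_space scaleM by fact
  interpret \<alpha>A: Vector_Spaces.linear scaleA scaleA \<alpha>\<^sub>A by (fact A.\<alpha>_linear)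
  interpret \<beta>A: Vector_Spaces.linear scaleA scaleA \<beta>\<^sub>A by (fact A.\<beta>_linear)
  interpret \<alpha>M: Vector_Spaces.linear scaleM scaleM \<alpha>\<^sub>M by fact
  interpret \<beta>M: Vector_Spaces.linear scaleM scaleM \<beta>\<^sub>M by fact
  interpret AA_left: Vector_Spaces.linear scaleA scaleA "\<lambda>a. mult a b" for b
    using A.mult_bilinear by (rule bilinear_map_left)
  interpret AA_right: Vector_Spaces.linear scaleA scaleA "mult a" for a
    using A.mult_bilinear by (rule bilinear_map_right)
  interpret l_left: Vector_Spaces.linear scaleA scaleM "\<lambda>a. lact a m" for m
    using assms(3) by (rule bilinear_map_left)
  interpret l_right: Vector_Spaces.linear scaleM scaleM "lact a" for a
    using assms(3) by (rule bilinear_map_right)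
  interpret r_left: Vector_Spaces.linear scaleM scaleM "\<lambda>m. ract m a" for a
    using assms(4) by (rule bilinear_map_left)
  interpret r_right: Vector_Spaces.linear scaleA scaleM "ract m" for m
    using assms(4) by (rule bilinear_map_right)
  note zero = \<alpha>A.zero \<beta>A.zero \<alpha>M.zero \<beta>M.zero AA_left.zero AA_right.zero
    l_left.zero l_right.zero r_left.zero r_right.zero
  \<comment> \<open>Sums arise only in the second component of a product, so additivity is needed
    only in module arguments.\<close>
  note add = \<alpha>M.add \<beta>M.add l_right.add r_left.add
  show ?thesis
  proof
    assume "bihom_pre_lie_algebra (module_prod.scale scaleA scaleM) (sum_mult mult lact ract)
      (map_prod \<alpha>\<^sub>A \<alpha>\<^sub>M) (map_prod \<beta>\<^sub>A \<beta>\<^sub>M)"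
    then interpret S: bihom_pre_lie_algebra "module_prod.scale scaleA scaleM"
      "sum_mult mult lact ract" "map_prod \<alpha>\<^sub>A \<alpha>\<^sub>M" "map_prod \<beta>\<^sub>A \<beta>\<^sub>M" .
    show "bihom_pre_lie_bimodule scaleA mult \<alpha>\<^sub>A \<beta>\<^sub>A scaleM lact ract \<alpha>\<^sub>M \<beta>\<^sub>M"
    proof (unfold_locales; (fact assms)?)
      fix a b c m
      \<comment> \<open>Multiplying \<open>(a, 0)\<close> by \<open>(0, m)\<close> gives
        \<open>(0, lact a m)\<close>, and the opposite order gives \<open>(0, ract m a)\<close>, so
        each action is isolated.\<close>
      show "\<alpha>\<^sub>M (lact a m) = lact (\<alpha>\<^sub>A a) (\<alpha>\<^sub>M m)"
        using S.\<alpha>_mult[of "(a, 0)" "(0, m)"] by (simp add: zero)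
      show "\<beta>\<^sub>M (lact a m) = lact (\<beta>\<^sub>A a) (\<beta>\<^sub>M m)"
        using S.\<beta>_mult[of "(a, 0)" "(0, m)"] by (simp add: zero)
      show "\<alpha>\<^sub>M (ract m a) = ract (\<alpha>\<^sub>M m) (\<alpha>\<^sub>A a)"
        using S.\<alpha>_mult[of "(0, m)" "(a, 0)"] by (simp add: zero)
      show "\<beta>\<^sub>M (ract m a) = ract (\<beta>\<^sub>M m) (\<beta>\<^sub>A a)"
        using S.\<beta>_mult[of "(0, m)" "(a, 0)"] by (simp add: zero)
      \<comment> \<open>With the module element in the third slot, only left actions
        survive.\<close>
      show "lact (\<alpha>\<^sub>A (\<beta>\<^sub>A a)) (lact (\<alpha>\<^sub>A b) m) - lact (mult (\<beta>\<^sub>A a) (\<alpha>\<^sub>A b)) (\<beta>\<^sub>M m) =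
        lact (\<alpha>\<^sub>A (\<beta>\<^sub>A b)) (lact (\<alpha>\<^sub>A a) m) - lact (mult (\<beta>\<^sub>A b) (\<alpha>\<^sub>A a)) (\<beta>\<^sub>M m)"
        using S.pre_lie[of "(a, 0)" "(b, 0)" "(0, m)"] by (simp add: zero)
      \<comment> \<open>With it in the second slot, the exchange of the first two arguments moves it
        to the front, where it is acted on from the right.\<close>
      show "lact (\<alpha>\<^sub>A (\<beta>\<^sub>A a)) (ract (\<alpha>\<^sub>M m) c) - ract (lact (\<beta>\<^sub>A a) (\<alpha>\<^sub>M m)) (\<beta>\<^sub>A c) =
        ract (\<alpha>\<^sub>M (\<beta>\<^sub>M m)) (mult (\<alpha>\<^sub>A a) c) - ract (ract (\<beta>\<^sub>M m) (\<alpha>\<^sub>A a)) (\<beta>\<^sub>A c)"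
        using S.pre_lie[of "(a, 0)" "(0, m)" "(c, 0)"] by (simp add: zero)
    qed
  next
    assume "bihom_pre_lie_bimodule scaleA mult \<alpha>\<^sub>A \<beta>\<^sub>A scaleM lact ract \<alpha>\<^sub>M \<beta>\<^sub>M"
    then interpret B: bihom_pre_lie_bimodule scaleA mult \<alpha>\<^sub>A \<beta>\<^sub>A scaleM lact ract \<alpha>\<^sub>M \<beta>\<^sub>M .
    let ?\<mu> = "sum_mult mult lact ract"
    let ?\<alpha> = "map_prod \<alpha>\<^sub>A \<alpha>\<^sub>M" and ?\<beta> = "map_prod \<beta>\<^sub>A \<beta>\<^sub>M"
    show "bihom_pre_lie_algebra (module_prod.scale scaleA scaleM) ?\<mu> ?\<alpha> ?\<beta>"
    proof (intro bihom_pre_lie_algebra.intro bihom_pre_lie_algebra_axioms.intro)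
      show "vector_space (module_prod.scale scaleA scaleM)"
        by (intro vector_space_prod_scale A.vector_space_axioms M.vector_space_axioms)
      show "bilinear_map (module_prod.scale scaleA scaleM) (module_prod.scale scaleA scaleM)
        (module_prod.scale scaleA scaleM) ?\<mu>"
        by (intro bilinear_map_sum_mult A.mult_bilinear assms A.vector_space_axioms)
      show "Vector_Spaces.linear (module_prod.scale scaleA scaleM)
        (module_prod.scale scaleA scaleM) ?\<alpha>"
        by (intro linear_map_prod A.\<alpha>_linear assms)
      show "Vector_Spaces.linear (module_prod.scale scaleA scaleM)
        (module_prod.scale scaleA scaleM) ?\<beta>"
        by (intro linear_map_prod A.\<beta>_linear assms)
      show "?\<alpha> \<circ> ?\<beta> = ?\<beta> \<circ> ?\<alpha>"
        by (simp add: map_prod_compose[symmetric] A.\<alpha>_\<beta>_commute assms(7))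
      fix x y z :: "'a \<times> 'm"
      obtain a m b n c p where xyz: "x = (a, m)" "y = (b, n)" "z = (c, p)"
        by (metis surj_pair)
      show "?\<alpha> (?\<mu> x y) = ?\<mu> (?\<alpha> x) (?\<alpha> y)"
        by (simp add: xyz A.\<alpha>_mult B.\<alpha>\<^sub>M_lact B.\<alpha>\<^sub>M_ract add)
      show "?\<beta> (?\<mu> x y) = ?\<mu> (?\<beta> x) (?\<beta> y)"
        by (simp add: xyz A.\<beta>_mult B.\<beta>\<^sub>M_lact B.\<beta>\<^sub>M_ract add)
      show "?\<mu> (?\<alpha> (?\<beta> x)) (?\<mu> (?\<alpha> y) z) - ?\<mu> (?\<mu> (?\<beta> x) (?\<alpha> y)) (?\<beta> z) =
        ?\<mu> (?\<alpha> (?\<beta> y)) (?\<mu> (?\<alpha> x) z) - ?\<mu> (?\<mu> (?\<beta> y) (?\<alpha> x)) (?\<beta> z)"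
        \<comment> \<open>\<open>A.pre_lie\<close> settles the first component. In the second, the
          terms in \<open>p\<close> and \<open>n\<close> match the identities at
          \<open>(a, b, p)\<close> and \<open>(a, n, c)\<close> as stated; those in \<open>m\<close>
          match the one at \<open>(b, m, c)\<close> with its sides exchanged, since \<open>m\<close>
          sits in the first argument.\<close>
        using A.pre_lie[of a b c]
          sum_diff_regroup[OF B.bimodule_left[of a b p]
            B.bimodule_right[of a n c] B.bimodule_right[of b m c]]
        by (simp add: xyz add add.assoc)
    qed
  qed
qed

end
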